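(* For every integer $n\ge2$, it is not the case that $(n;n,2n-2)\xrightarrow{\textsc{ad}} n$; hence $\textsc{ad}(n;n,2n-2)<n$. That is, there is an instance of the admissible division problem with $n$ agents and two cakes, the first cut into $n$ slices and the second into $2n-2$ slices, such that for every partition $P$, $\nu^D(P)\le n-1$.
   Context: Admissible division. Let $\Delta_{a-1}=\{x\in\mathbb{R}^a_{\ge0}:\sum_i x_i=1\}$ and $\mathcal{P}=\prod_{t=1}^d\Delta_{a_t-1}$; $P=(P^1,\ldots,P^d)\in\mathcal{P}$ represents a division of $d$ cakes (copies of $[0,1]$), cake $t$ cut into $a_t$ consecutive slices of lengths $P^t_1,\ldots,P^t_{a_t}$. Let $\mathcal{J}=[a_1]\times\cdots\times[a_d]$; $\vec j=(j_1,\ldots,j_d)$ denotes the $d$-tuple consisting of slice $j_t$ of cake $t$. An instance with $n$ agents consists of, for each agent $i$, a map $L^i$ assigning to every $P\in\mathcal{P}$ a set $L^i(P)\subseteq\mathcal{J}$ such that (i) for each $\vec j$ the set $\{P:\vec j\in L^i(P)\}$ is closed, and (ii) for every $P$ there is $\vec j\in L^i(P)$ with $P^t_{j_t}>0$ for all $t$. $\nu^D(P)$ is the largest size of a set $Q$ of agents with a map $\phi:Q\to\mathcal{J}$ such that $\phi(q)\in L^q(P)$ for all $q$ and distinct $q,q'$ get vectors differing in every coordinate. $(n;a_1,\ldots,a_d)\xrightarrow{\textsc{ad}} m$ means that for every instance with $n$ agents some $P$ has $\nu^D(P)\ge m$; $\textsc{ad}(n;a_1,\ldots,a_d)$ is the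 largest such $m$. *)

theory Defs
  imports "HOL-Analysis.Analysis" "HOL-Homology.Simplices"
begin

text \<open>
  The sizes are given by a list \<open>as = [a\<^sub>1, \<dots>, a\<^sub>d]\<close> of positive numbers. Cakes, slices and
  agents are numbered from 0. A division is a function \<open>P\<close>, where \<open>P t j\<close> is the length of
  slice \<open>j\<close> of cake \<open>t\<close>, padded with zeros at unused indices. So the set of divisions is a copy
  of the product of simplices, and the subspace topology it inherits from the product topology
  on \<open>nat \<Rightarrow> nat \<Rightarrow> real\<close> is the Euclidean one.
\<close>

definition divisions :: "nat list \<Rightarrow> (nat \<Rightarrow> nat \<Rightarrow> real) set" where
  "divisions as = {P. (\<forall>t<length as. P t \<in> standard_simplex (as ! t - 1)) \<and>
                      (\<forall>t\<ge>length as. \<forall>j. P t j = 0)}"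

definition slice_tuples :: "nat list \<Rightarrow> nat list set" where
  "slice_tuples as = {js. length js = length as \<and> (\<forall>t<length as. js ! t < as ! t)}"

definition admissible_preference ::
    "nat list \<Rightarrow> ((nat \<Rightarrow> nat \<Rightarrow> real) \<Rightarrow> nat list set) \<Rightarrow> bool" where
  "admissible_preference as L \<longleftrightarrow>
     (\<forall>P\<in>divisions as. L P \<subseteq> slice_tuples as) \<and>
     (\<forall>js\<in>slice_tuples as.
        closedin (top_of_set (divisions as)) {P \<in> divisions as. js \<in> L P}) \<and>
     (\<forall>P\<in>divisions as. \<exists>js\<in>L P. \<forall>t<length as. P t (js ! t) > 0)"

definition ad_instance ::
    "nat \<Rightarrow> nat list \<Rightarrow> (nat \<Rightarrow> (nat \<Rightarrow> nat \<Rightarrow> real) \<Rightarrow> nat list set) \<Rightarrow> bool" where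
  "ad_instance n as L \<longleftrightarrow> (\<forall>i<n. admissible_preference as (L i))"

definition nuD ::
    "nat \<Rightarrow> nat list \<Rightarrow> (nat \<Rightarrow> (nat \<Rightarrow> nat \<Rightarrow> real) \<Rightarrow> nat list set) \<Rightarrow>
     (nat \<Rightarrow> nat \<Rightarrow> real) \<Rightarrow> nat" where
  "nuD n as L P = Max {card Q | Q. Q \<subseteq> {..<n} \<and>
     (\<exists>\<phi>. \<phi> \<in> Q \<rightarrow> slice_tuples as \<and>
          (\<forall>q\<in>Q. \<phi> q \<in> L q P) \<and>
          (\<forall>q\<in>Q. \<forall>q'\<in>Q. q \<noteq> q' \<longrightarrow> (\<forall>t<length as. \<phi> q ! t \<noteq> \<phi> q' ! t)))}"

definition ad_arrow :: "nat \<Rightarrow> nat list \<Rightarrow> nat \<Rightarrow> bool" where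
  "ad_arrow n as m \<longleftrightarrow>
     (\<forall>L. ad_instance n as L \<longrightarrow> (\<exists>P\<in>divisions as. nuD n as L P \<ge> m))"

definition ad_number :: "nat \<Rightarrow> nat list \<Rightarrow> nat" where
  "ad_number n as = (GREATEST m. ad_arrow n as m)"

end

theory Submission
  imports Defs
begin

text \<open>
  Call the first \<open>n - 1\<close> slices of the second cake \<^emph>\<open>low\<close> and the other \<open>n - 1\<close> slices \<^emph>\<open>high\<close>. If all
  \<open>n\<close> agents are served, then each slice of the first cake is used once, and both low and high
  slices are used. Arrange the agents and the slices of the first cake in a cycle: agent \<open>i\<close> asks
  for slice \<open>i\<close> together with a low slice, or for slice \<open>i + 1\<close> together with a high slice. As in
  Drisko's example of \<open>2n - 2\<close> matchings without a rainbow matching, the only perfect matchings of a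
  cycle are the two alternating ones, so that all agents would use slices of the same kind.

  The first cake may have tiny slices, and one half of the second cake may be tiny. Agents then
  fall back to large slices of the first cake. With \<open>y\<close> the total length of the low slices, only
  high slices are wanted for \<open>y < 1/3\<close> and only low slices for \<open>y > 2/3\<close>. Slice \<open>i\<close> is acceptable to
  agent \<open>i\<close> from length \<open>1/(2n)\<close> on, but to agent \<open>i - 1\<close> already from length \<open>1/(3n)\<close> on. This gap
  ensures that whenever a fallback could spoil the cyclic structure, some slice of the first cake is
  too short for everyone who could still take it.
\<close>

text \<open>The last disjunct is the fallback to a slice of at least average length. All
  inequalities are weak, so agents are indifferent at the thresholds and the preference sets come
  out closed.\<close>

definition wants_low :: "nat \<Rightarrow> (nat \<Rightarrow> real) \<Rightarrow> real \<Rightarrow> nat \<Rightarrow> nat \<Rightarrow> bool" where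
  "wants_low n x y i j \<longleftrightarrow> 1/3 \<le> y \<and>
     (j = i \<and> 1 / (2 * real n) \<le> x i \<or>
      1 / real n \<le> x j \<and> x i \<le> 1 / (2 * real n) \<and>
        (2/3 \<le> y \<or> x (Suc i mod n) \<le> 1 / (3 * real n)))"

definition wants_high :: "nat \<Rightarrow> (nat \<Rightarrow> real) \<Rightarrow> real \<Rightarrow> nat \<Rightarrow> nat \<Rightarrow> bool" where
  "wants_high n x y i j \<longleftrightarrow>
     j = Suc i mod n \<and> 1 / (3 * real n) \<le> x j \<and>
       (y \<le> 1/3 \<or> y \<le> 2/3 \<and> x i \<le> 1 / (2 * real n)) \<or>
     y \<le> 1/3 \<and> x (Suc i mod n) \<le> 1 / (3 * real n) \<and> 1 / real n \<le> x j"

text \<open>The bound \<open>1 / (3 * real n)\<close> on the second slice is a closed substitute for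
  positive length. It can be met in either half whose total length is at least 1/3, since a half has
  only \<open>n - 1\<close> slices.\<close>

definition cyclic_preference ::
    "nat \<Rightarrow> nat \<Rightarrow> (nat \<Rightarrow> nat \<Rightarrow> real) \<Rightarrow> nat list set" where
  "cyclic_preference n i P =
     {js \<in> slice_tuples [n, 2 * n - 2]. 1 / (3 * real n) \<le> P 1 (js ! 1) \<and>
        (if js ! 1 < n - 1 then wants_low n (P 0) (\<Sum>k<n-1. P 1 k) i (js ! 0)
         else wants_high n (P 0) (\<Sum>k<n-1. P 1 k) i (js ! 0))}"

lemma slice_tuples_pair:
  "js \<in> slice_tuples [a, b] \<longleftrightarrow> (\<exists>j<a. \<exists>k<b. js = [j, k])"
  by (auto simp: slice_tuples_def less_Suc_eq length_Suc_conv numeral_2_eq_2)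

lemma exists_large_summand:
  fixes f :: "'a \<Rightarrow> real"
  assumes "finite A" "sum f A \<ge> c" "real (card A) * e \<le> c" "A \<noteq> {}"
  shows "\<exists>k\<in>A. e \<le> f k"
proof (rule ccontr)
  assume "\<not> ?thesis"
  then have "sum f A < real (card A) * e"
    using sum_bounded_above_strict[of A f e] assms(1,4) by (auto simp: card_gt_0_iff not_le)
  then show False using assms(2,3) by linarith
qed

lemma divisions_pair:
  assumes "P \<in> divisions [a, b]" "a > 0" "b > 0"
  shows "(\<Sum>j<a. P 0 j) = 1" "(\<Sum>k<b. P 1 k) = 1"
proof -
  have "P 0 \<in> standard_simplex (a - 1)" "P 1 \<in> standard_simplex (b - 1)"
    using assms(1) by (auto simp: divisions_def less_Suc_eq)
  moreover have "{..a - 1} = {..<a}" "{..b - 1} = {..<b}" using assms(2,3) by auto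
  ultimately show "(\<Sum>j<a. P 0 j) = 1" "(\<Sum>k<b. P 1 k) = 1"
    by (auto simp: standard_simplex_def)
qed

lemma divisions_pair_nonempty: "divisions [a, b] \<noteq> {}"
proof -
  have "(\<lambda>t j. if t < 2 \<and> j = 0 then 1 else 0) \<in> divisions [a, b]"
    by (auto simp: divisions_def standard_simplex_def)
  then show ?thesis by blast
qed

section \<open>Admissibility of the preferences\<close>

lemma wants_exists:
  assumes n: "n \<ge> 2" "i < n" and sum1: "(\<Sum>j<n. x j) = 1"
  shows "\<exists>j<n. x j > 0 \<and> (y \<ge> 1/3 \<and> wants_low n x y i j \<or> y \<le> 2/3 \<and> wants_high n x y i j)"
proof -
  obtain j0 where j0: "j0 < n" "1 / real n \<le> x j0"
    using exists_large_summand[of "{..<n}" 1 x "1 / real n"] n sum1 by auto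
  define s where "s = Suc i mod n"
  define \<alpha> where "\<alpha> = 1 / (2 * real n)"
  define \<beta> where "\<beta> = 1 / (3 * real n)"
  have s: "s < n" using n by (simp add: s_def)
  have pos: "0 < 1 / real n" "0 < \<alpha>" "0 < \<beta>" using n by (auto simp: \<alpha>_def \<beta>_def)
  have j0pos: "x j0 > 0" using j0 pos by linarith
  have low: "wants_low n x y i j \<longleftrightarrow> 1/3 \<le> y \<and>
      (j = i \<and> \<alpha> \<le> x i \<or> 1 / real n \<le> x j \<and> x i \<le> \<alpha> \<and> (2/3 \<le> y \<or> x s \<le> \<beta>))" for j
    by (simp add: wants_low_def s_def \<alpha>_def \<beta>_def)
  have high: "wants_high n x y i j \<longleftrightarrow>
      j = s \<and> \<beta> \<le> x j \<and> (y \<le> 1/3 \<or> y \<le> 2/3 \<and> x i \<le> \<alpha>) \<or>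
      y \<le> 1/3 \<and> x s \<le> \<beta> \<and> 1 / real n \<le> x j" for j
    by (simp add: wants_high_def s_def \<alpha>_def \<beta>_def)
  \<comment> \<open>The cases overlap at the thresholds and cover everything. They lead in turn to
    the successor slice, the high fallback, the own slice, the low fallback and again the successor
    slice.\<close>
  consider
      "y \<le> 1/3" "x s \<ge> \<beta>"
    | "y \<le> 1/3" "x s \<le> \<beta>"
    | "y \<ge> 1/3" "x i \<ge> \<alpha>"
    | "y \<ge> 1/3" "x i \<le> \<alpha>" "y \<ge> 2/3 \<or> x s \<le> \<beta>"
    | "y \<le> 2/3" "x i \<le> \<alpha>" "x s \<ge> \<beta>"
    by (meson linear)
  then show ?thesis
  proof cases
    case 1
    then have "wants_high n x y i s" "y \<le> 2/3" "x s > 0" using pos by (simp_all add: high)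
    then show ?thesis using s by blast
  next
    case 2
    then have "wants_high n x y i j0" "y \<le> 2/3" using j0 by (simp_all add: high)
    then show ?thesis using j0 j0pos by blast
  next
    case 3
    then have "wants_low n x y i i" "x i > 0" using pos by (simp_all add: low)
    then show ?thesis using 3 n by blast
  next
    case 4
    then have "wants_low n x y i j0" using j0 by (simp add: low)
    then show ?thesis using 4 j0 j0pos by blast
  next
    case 5
    then have "wants_high n x y i s" "x s > 0" using pos by (simp_all add: high)
    then show ?thesis using 5 s by blast
  qed
qed

lemma admissible_cyclic_preference:
  assumes n: "n \<ge> 2" "i < n"
  shows "admissible_preference [n, 2 * n - 2] (cyclic_preference n i)"
  unfolding admissible_preference_def
proof (intro conjI ballI)
  fix P :: "nat \<Rightarrow> nat \<Rightarrow> real"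
  show "cyclic_preference n i P \<subseteq> slice_tuples [n, 2 * n - 2]"
    by (auto simp: cyclic_preference_def)
next
  fix js
  assume js: "js \<in> slice_tuples [n, 2 * n - 2]"
  have cont: "continuous_on UNIV (\<lambda>P :: nat \<Rightarrow> nat \<Rightarrow> real. P t j)" for t j
    by (rule continuous_on_product_then_coordinatewise[OF continuous_on_product_coordinates])
  note closed_intros = closed_Collect_const closed_Collect_conj closed_Collect_disj
    closed_Collect_le cont continuous_on_const continuous_on_sum
  have "closed {P :: nat \<Rightarrow> nat \<Rightarrow> real. wants_low n (P 0) (\<Sum>k<n-1. P 1 k) i j}"
    and "closed {P :: nat \<Rightarrow> nat \<Rightarrow> real. wants_high n (P 0) (\<Sum>k<n-1. P 1 k) i j}"
    and "closed {P :: nat \<Rightarrow> nat \<Rightarrow> real. 1 / (3 * real n) \<le> P 1 j}" for j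
    unfolding wants_low_def wants_high_def by (intro closed_intros)+
  \<comment> \<open>Whether the second slice is low depends on \<open>js\<close> alone, so the
    conditional picks the same branch for all \<open>P\<close>.\<close>
  then have "closed {P. js \<in> cyclic_preference n i P}"
    using js unfolding cyclic_preference_def
    by (cases "js ! 1 < n - 1") (simp_all add: closed_Collect_conj)
  moreover have "{P \<in> divisions [n, 2 * n - 2]. js \<in> cyclic_preference n i P} =
      divisions [n, 2 * n - 2] \<inter> {P. js \<in> cyclic_preference n i P}"
    by blast
  ultimately show "closedin (top_of_set (divisions [n, 2 * n - 2]))
      {P \<in> divisions [n, 2 * n - 2]. js \<in> cyclic_preference n i P}"
    by (simp add: closedin_closed_Int)
next
  fix P
  assume P: "P \<in> divisions [n, 2 * n - 2]"
  let ?y = "\<Sum>k<n-1. P 1 k"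
  have sum1: "(\<Sum>j<n. P 0 j) = 1" and sum2: "(\<Sum>k<2*n-2. P 1 k) = 1"
    using divisions_pair[OF P] n by auto
  have "(\<Sum>k<2*n-2. P 1 k) = ?y + (\<Sum>k=n-1..<2*n-2. P 1 k)"
    using sum.atLeastLessThan_concat[of 0 "n - 1" "2*n-2" "P 1"] n
    by (simp add: atLeast0LessThan)
  then have high_sum: "(\<Sum>k=n-1..<2*n-2. P 1 k) = 1 - ?y" using sum2 by simp
  have small: "real (n - 1) * (1 / (3 * real n)) \<le> 1/3"
    using n by (simp add: field_simps of_nat_diff)
  have pos: "0 < 1 / (3 * real n)" using n by simp
  have ne: "{..<n-1} \<noteq> {}" "{n-1..<2*n-2} \<noteq> {}" and card: "card {n-1..<2*n-2} = n - 1"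
    using n by (auto simp: lessThan_empty_iff)
  obtain j where j: "j < n" "P 0 j > 0"
      "?y \<ge> 1/3 \<and> wants_low n (P 0) ?y i j \<or> ?y \<le> 2/3 \<and> wants_high n (P 0) ?y i j"
    using wants_exists[OF n sum1] by blast
  obtain k where k: "k < 2*n-2" "1 / (3 * real n) \<le> P 1 k"
      "if k < n - 1 then wants_low n (P 0) ?y i j else wants_high n (P 0) ?y i j"
    using j(3)
  proof (elim disjE conjE)
    assume "?y \<ge> 1/3" "wants_low n (P 0) ?y i j"
    moreover from this obtain k where "k < n - 1" "1 / (3 * real n) \<le> P 1 k"
      using exists_large_summand[of "{..<n-1}" "1/3" "P 1" "1 / (3 * real n)"] small ne
      by (simp only: card_lessThan finite_lessThan) blast
    ultimately show ?thesis using that[of k] by simp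
  next
    assume "?y \<le> 2/3" "wants_high n (P 0) ?y i j"
    moreover from this obtain k where "k \<in> {n-1..<2*n-2}" "1 / (3 * real n) \<le> P 1 k"
      using exists_large_summand[of "{n-1..<2*n-2}" "1/3" "P 1" "1 / (3 * real n)"] small ne high_sum
      by (simp only: card finite_atLeastLessThan) force
    ultimately show ?thesis using that[of k] by simp
  qed
  have "[j, k] \<in> cyclic_preference n i P"
    using j k by (auto simp: cyclic_preference_def slice_tuples_pair)
  moreover have "\<forall>t<length [n, 2*n-2]. P t ([j, k] ! t) > 0"
    using j(2) less_le_trans[OF pos k(2)] by (simp add: less_Suc_eq)
  ultimately show "\<exists>js\<in>cyclic_preference n i P. \<forall>t<length [n, 2*n-2]. P t (js ! t) > 0"
    by blast
qed

section \<open>Perfect matchings on the cycle\<close>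

lemma Suc_mod_inj:
  assumes "Suc a mod n = Suc b mod n" "a < n" "b < n"
  shows "a = b"
  using assms by (auto simp: mod_Suc split: if_splits)

lemma cyclic_induct:
  fixes m i n :: nat
  assumes "Q m" "m < n" "i < n" and step: "\<And>k. k < n \<Longrightarrow> Q k \<Longrightarrow> Q (Suc k mod n)"
  shows "Q i"
proof -
  have "Q ((m + d) mod n)" for d
  proof (induction d)
    case 0
    then show ?case using assms by simp
  next
    case (Suc d)
    then show ?case using step[of "(m + d) mod n"] assms(2) by (simp add: mod_Suc_eq)
  qed
  \<comment> \<open>Going once around the cycle avoids truncated subtraction when
    \<open>i < m\<close>.\<close>
  from this[of "n - m + i"] show ?thesis using assms(2,3) by simp
qed

text \<open>Lowness passes from \<open>k\<close> to its successor \<open>s\<close>: were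
  \<open>s\<close> high, slice \<open>s\<close> could only go to a high agent whose successor is
  \<open>s\<close>. That agent is \<open>k\<close>, which is low.\<close>

lemma cyclic_matching_all_low:
  fixes x :: "nat \<Rightarrow> real"
  assumes n: "n \<ge> 2"
    and inj: "inj_on a {..<n}" and range: "a ` {..<n} \<subseteq> {..<n}"
    and wants: "\<And>i. i < n \<Longrightarrow> if low i then wants_low n x y i (a i) else wants_high n x y i (a i)"
    and m: "m < n" "low m" and i: "i < n"
  shows "low i"
proof -
  have surj: "a ` {..<n} = {..<n}"
    using inj range by (intro card_subset_eq) (auto simp: card_image)
  have ord: "1 / (3 * real n) < 1 / (2 * real n)" "1 / (2 * real n) < 1 / real n"
    using n by (auto simp: field_simps)
  have y: "y \<ge> 1/3" using wants[OF m(1)] m(2) by (simp add: wants_low_def)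
  have succ_ne: "Suc k mod n \<noteq> k" if "k < n" for k
    using that n by (auto simp: mod_Suc)
  \<comment> \<open>At \<open>y = 1/3\<close> a fallback of \<open>k\<close> requires its successor
    slice to have length at most \<open>1 / (3 * real n)\<close>. Some other agent must take that
    slice, but it is too short as an own slice or as a fallback, and it is the successor slice of
    \<open>k\<close> only.\<close>
  have no_fallback: "a k = (if low k then k else Suc k mod n)" if k: "k < n" and y3: "y = 1/3" for k
  proof (rule ccontr)
    assume ne: "a k \<noteq> (if low k then k else Suc k mod n)"
    then have short: "x (Suc k mod n) \<le> 1 / (3 * real n)" and long: "1 / real n \<le> x (a k)"
      using wants[OF k] y3 by (auto simp: wants_low_def wants_high_def split: if_splits)
    have "Suc k mod n \<in> a ` {..<n}" using surj n by simp
    then obtain l where l: "l < n" "a l = Suc k mod n" by auto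
    have "l \<noteq> k" using short long l ord by auto
    then have "Suc l mod n \<noteq> Suc k mod n" using Suc_mod_inj l(1) k by blast
    then show False
      using wants[OF l(1)] l short ord y3
      by (auto simp: wants_low_def wants_high_def split: if_splits)
  qed
  show ?thesis
  proof (rule cyclic_induct[of low m n i])
    fix k
    assume k: "k < n" "low k"
    define s where "s = Suc k mod n"
    have s: "s < n" using n by (simp add: s_def)
    show "low (Suc k mod n)"
    proof (rule ccontr)
      assume "\<not> low (Suc k mod n)"
      then have high: "\<not> low s" by (simp add: s_def)
      obtain l where l: "l < n" "a l = s" using surj s by (metis imageE lessThan_iff)
      have "\<not> low l \<and> a l = Suc l mod n"
      proof (cases "y = 1/3")
        case True
        then show ?thesis
          using no_fallback[OF l(1)] no_fallback[OF s] l high succ_ne[OF s]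
          by (auto split: if_splits)
      next
        case False
        then have gt: "y > 1/3" using y by simp
        \<comment> \<open>Above 1/3 high agents have no fallback, and slice \<open>s\<close> is too
          short to be a low fallback. A low taker would thus have to be \<open>s\<close> itself,
          which is high.\<close>
        then have "a s = Suc s mod n" "x s \<le> 1 / (2 * real n)"
          using wants[OF s] high by (auto simp: wants_high_def)
        then show ?thesis
          using wants[OF l(1)] l gt ord high succ_ne[OF s]
          by (auto simp: wants_low_def wants_high_def split: if_splits)
      qed
      then have "\<not> low l" "Suc l mod n = Suc k mod n" using l(2) unfolding s_def by simp_all
      then show False using Suc_mod_inj l(1) k by blast
    qed
  qed (use m i in auto)
qed

section \<open>The bound on the number of served agents\<close>

lemma nuD_cyclic_preference:
  assumes n: "n \<ge> 2"
  shows "nuD n [n, 2 * n - 2] (cyclic_preference n) P \<le> n - 1"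
proof -
  let ?as = "[n, 2 * n - 2]"
  let ?M = "\<lambda>Q. Q \<subseteq> {..<n} \<and>
     (\<exists>\<phi>. \<phi> \<in> Q \<rightarrow> slice_tuples ?as \<and>
          (\<forall>q\<in>Q. \<phi> q \<in> cyclic_preference n q P) \<and>
          (\<forall>q\<in>Q. \<forall>q'\<in>Q. q \<noteq> q' \<longrightarrow> (\<forall>t<length ?as. \<phi> q ! t \<noteq> \<phi> q' ! t)))"
  have "\<not> ?M {..<n}"
  proof
    assume "?M {..<n}"
    then obtain \<phi> where "\<phi> \<in> {..<n} \<rightarrow> slice_tuples ?as"
        and "\<forall>q\<in>{..<n}. \<phi> q \<in> cyclic_preference n q P"
        and "\<forall>q\<in>{..<n}. \<forall>q'\<in>{..<n}. q \<noteq> q' \<longrightarrow> (\<forall>t<length ?as. \<phi> q ! t \<noteq> \<phi> q' ! t)"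
      by blast
    then have tuple: "\<phi> q \<in> slice_tuples ?as" and pref: "\<phi> q \<in> cyclic_preference n q P"
      and diff: "q' < n \<Longrightarrow> q \<noteq> q' \<Longrightarrow> t < 2 \<Longrightarrow> \<phi> q ! t \<noteq> \<phi> q' ! t" if "q < n" for q q' t
      using that by (auto simp: Pi_iff)
    define a where "a q = \<phi> q ! 0" for q
    define b where "b q = \<phi> q ! 1" for q
    have inj: "inj_on a {..<n}" "inj_on b {..<n}"
      using diff by (force simp: inj_on_def a_def b_def)+
    have range: "a q < n" "b q < 2 * n - 2" if "q < n" for q
      using tuple[OF that] by (auto simp: slice_tuples_pair a_def b_def)
    \<comment> \<open>Each half has \<open>n - 1\<close> slices, so \<open>n\<close> distinct slices
      meet both halves. This yields a low agent \<open>m\<close> and a high agent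
      \<open>i\<close>.\<close>
    have pigeonhole: "\<not> b ` {..<n} \<subseteq> S" if "finite S" "card S = n - 1" for S
    proof
      assume "b ` {..<n} \<subseteq> S"
      from card_mono[OF that(1) this] have "card {..<n} \<le> n - 1"
        unfolding card_image[OF inj(2)] that(2) .
      then show False using n unfolding card_lessThan by linarith
    qed
    obtain m where m: "m < n" "b m < n - 1"
    proof -
      have "\<not> b ` {..<n} \<subseteq> {n-1..<2*n-2}" using n by (intro pigeonhole) auto
      then obtain q where "q < n" "b q \<notin> {n-1..<2*n-2}" by blast
      then show ?thesis using that[of q] range(2)[of q] by simp
    qed
    obtain i where i: "i < n" "\<not> b i < n - 1"
    proof -
      have "\<not> b ` {..<n} \<subseteq> {..<n-1}" by (intro pigeonhole) auto
      then show ?thesis using that by blast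
    qed
    have "b i < n - 1"
    proof (rule cyclic_matching_all_low[where a = a and low = "\<lambda>q. b q < n - 1" and m = m])
      fix q
      assume "q < n"
      then show "if b q < n - 1 then wants_low n (P 0) (\<Sum>k<n-1. P 1 k) q (a q)
          else wants_high n (P 0) (\<Sum>k<n-1. P 1 k) q (a q)"
        using pref[of q] unfolding cyclic_preference_def a_def b_def by blast
    qed (use n inj range m i in auto)
    then show False using i by simp
  qed
  then have bound: "card Q \<le> n - 1" if "?M Q" for Q
  proof -
    have "Q \<subset> {..<n}" using that \<open>\<not> ?M {..<n}\<close> by blast
    then have "card Q < n" using psubset_card_mono[of "{..<n}" Q] by simp
    then show ?thesis by simp
  qed
  have "finite {card Q | Q. ?M Q}"
    by (rule finite_subset[of _ "{..n - 1}"]) (use bound in blast)+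
  \<comment> \<open>The empty matching makes the maximum one over a nonempty set.\<close>
  moreover have "?M {}" by simp
  then have "{card Q | Q. ?M Q} \<noteq> {}" by blast
  ultimately have "Max {card Q | Q. ?M Q} \<le> n - 1"
    using bound by (subst Max_le_iff) blast+
  then show ?thesis unfolding nuD_def .
qed

theorem theorem6p12:
  fixes n :: nat
  assumes "n \<ge> 2"
  shows "\<not> ad_arrow n [n, 2 * n - 2] n \<and>
         ad_number n [n, 2 * n - 2] < n \<and>
         (\<exists>L. ad_instance n [n, 2 * n - 2] L \<and>
              (\<forall>P\<in>divisions [n, 2 * n - 2]. nuD n [n, 2 * n - 2] L P \<le> n - 1))"
proof -
  let ?as = "[n, 2 * n - 2]"
  have inst: "ad_instance n ?as (cyclic_preference n)"
    using admissible_cyclic_preference assms by (simp add: ad_instance_def)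
  have bound: "m < n" if "ad_arrow n ?as m" for m
  proof -
    obtain P where "nuD n ?as (cyclic_preference n) P \<ge> m"
      using \<open>ad_arrow n ?as m\<close> inst unfolding ad_arrow_def by blast
    then show ?thesis using nuD_cyclic_preference[OF assms, of P] assms by linarith
  qed
  \<comment> \<open>\<open>GREATEST\<close> attains its value only if some \<open>m\<close>
    qualifies; for 0 any division will do.\<close>
  have zero: "ad_arrow n ?as 0"
    using divisions_pair_nonempty by (auto simp: ad_arrow_def)
  have "ad_arrow n ?as (ad_number n ?as)"
    unfolding ad_number_def by (rule GreatestI_nat[where P = "ad_arrow n ?as", OF zero]) (rule less_imp_le[OF bound])
  then show ?thesis
    using bound inst nuD_cyclic_preference[OF assms] by blast
qed

end
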